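(* Consider the planar systems $\dot v=\mu v-\omega w+f(v,w)$, $\dot w=\omega v+\mu w+g(v,w)$, $\omega\ne0$, with $$f=a_{11}v|v|+a_{12}v|w|+a_{21}w|v|+a_{22}w|w|,\qquad g=b_{11}v|v|+b_{12}v|w|+b_{21}w|v|+b_{22}w|w|.$$ There is no smooth approximation of the absolute value function with nonzero quadratic term that preserves the criticality of the nonsmooth case for all $f,g$; here all absolute value terms in $f,g$ are approximated in the same way.
   Context: $a_{ij},b_{ij}$ are real coefficients and $\mu\in\mathbb{R}$ is the bifurcation parameter. The criticality of the nonsmooth Hopf bifurcation at $\mu=0$ is determined by the sign of $\sigma_{\#}=2a_{11}+a_{12}+b_{21}+2b_{22}$: subcritical if $\sigma_{\#}>0$, supercritical if $\sigma_{\#}<0$. The criticality of the Hopf bifurcation of the smoothed system is determined by the sign of its classical first Lyapunov coefficient: subcritical if positive, supercritical if negative. "Preserves the criticality for all $f,g$" means that for all choices of the coefficients the smoothed system has the same criticality as the nonsmooth one. *)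

theory Defs
  imports "HOL-Analysis.Analysis"
begin

definition smooth :: "(real \<Rightarrow> real) \<Rightarrow> bool" where
  "smooth \<phi> \<longleftrightarrow> (\<forall>n x. (deriv ^^ n) \<phi> differentiable (at x))"

text \<open>
  Smooth approximations come as families such as \<open>sqrt (x\<^sup>2 + \<epsilon>\<^sup>2)\<close> or
  \<open>2 / pi * x * arctan (x / \<epsilon>)\<close>. Only pointwise convergence is asked for; in particular
  \<open>\<Phi> \<epsilon> 0\<close> need not vanish and \<open>\<Phi> \<epsilon>\<close> need not be even.
\<close>

definition smooth_abs_approximation :: "(real \<Rightarrow> real \<Rightarrow> real) \<Rightarrow> bool" where
  "smooth_abs_approximation \<Phi> \<longleftrightarrow>
     (\<forall>\<epsilon>>0. smooth (\<Phi> \<epsilon>)) \<and>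
     (\<forall>x. ((\<lambda>\<epsilon>. \<Phi> \<epsilon> x) \<longlongrightarrow> \<bar>x\<bar>) (at_right 0))"

definition nonlinearity :: "(real \<Rightarrow> real) \<Rightarrow> real^2^2 \<Rightarrow> real \<Rightarrow> real \<Rightarrow> real" where
  "nonlinearity \<phi> c v w =
     c$1$1 * v * \<phi> v + c$1$2 * v * \<phi> w + c$2$1 * w * \<phi> v + c$2$2 * w * \<phi> w"

text \<open>The nonsmooth system is the case \<open>\<phi> = abs\<close>; a smoothing replaces every \<open>abs\<close> by the same \<open>\<phi>\<close>.\<close>

definition planar_field ::
    "(real \<Rightarrow> real) \<Rightarrow> real \<Rightarrow> real^2^2 \<Rightarrow> real^2^2 \<Rightarrow> real \<Rightarrow> real^2 \<Rightarrow> real^2" where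
  "planar_field \<phi> \<omega> a b \<mu> x =
     (let v = x$1; w = x$2 in
      vector [\<mu> * v - \<omega> * w + nonlinearity \<phi> a v w,
              \<omega> * v + \<mu> * w + nonlinearity \<phi> b v w])"

text \<open>
  The nonsmooth Hopf bifurcation (at \<open>\<mu> = 0\<close>) is subcritical if this is positive and
  supercritical if it is negative.
\<close>

definition sigma_nonsmooth :: "real^2^2 \<Rightarrow> real^2^2 \<Rightarrow> real" where
  "sigma_nonsmooth a b = 2 * a$1$1 + a$1$2 + b$2$1 + 2 * b$2$2"

definition partial :: "2 \<Rightarrow> (real^2 \<Rightarrow> real) \<Rightarrow> real^2 \<Rightarrow> real" where
  "partial i h x = deriv (\<lambda>t. h (x + t *\<^sub>R axis i 1)) 0"

definition jacobian0 :: "(real^2 \<Rightarrow> real^2) \<Rightarrow> complex^2^2" where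
  "jacobian0 F = (\<chi> i j. complex_of_real (partial j (\<lambda>x. F x $ i) 0))"

definition bilinear_part :: "(real^2 \<Rightarrow> real^2) \<Rightarrow> complex^2 \<Rightarrow> complex^2 \<Rightarrow> complex^2" where
  "bilinear_part F x y =
     (\<chi> i. \<Sum>j\<in>UNIV. \<Sum>k\<in>UNIV.
        complex_of_real (partial j (partial k (\<lambda>z. F z $ i)) 0) * x$j * y$k)"

definition trilinear_part ::
    "(real^2 \<Rightarrow> real^2) \<Rightarrow> complex^2 \<Rightarrow> complex^2 \<Rightarrow> complex^2 \<Rightarrow> complex^2" where
  "trilinear_part F x y z =
     (\<chi> i. \<Sum>j\<in>UNIV. \<Sum>k\<in>UNIV. \<Sum>l\<in>UNIV.
        complex_of_real (partial j (partial k (partial l (\<lambda>u. F u $ i))) 0) * x$j * y$k * z$l)"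

definition cinner2 :: "complex^2 \<Rightarrow> complex^2 \<Rightarrow> complex" where
  "cinner2 p q = (\<Sum>i\<in>UNIV. cnj (p$i) * q$i)"

definition cconj2 :: "complex^2 \<Rightarrow> complex^2" where
  "cconj2 q = (\<chi> i. cnj (q$i))"

text \<open>
  The origin is an equilibrium whose linearization has the eigenvalues \<open>\<plusminus>\<i>\<omega>\<^sub>0\<close>;
  \<open>q\<close> is an eigenvector and \<open>p\<close> an adjoint eigenvector. For \<open>planar_field\<close>
  the trace of the linearization is \<open>2\<mu>\<close> plus a constant, so the eigenvalues cross the
  imaginary axis with unit speed in \<open>\<mu>\<close> and transversality need not be required.
\<close>

definition hopf_eigendata ::
    "(real^2 \<Rightarrow> real^2) \<Rightarrow> real \<Rightarrow> complex^2 \<Rightarrow> complex^2 \<Rightarrow> bool" where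
  "hopf_eigendata F \<omega>\<^sub>0 q p \<longleftrightarrow>
     F 0 = 0 \<and> \<omega>\<^sub>0 > 0 \<and>
     jacobian0 F *v q = (\<i> * complex_of_real \<omega>\<^sub>0) *s q \<and>
     transpose (jacobian0 F) *v p = (- \<i> * complex_of_real \<omega>\<^sub>0) *s p \<and>
     cinner2 p q = 1"

text \<open>
  Kuznetsov's formula \<open>1 / (2\<omega>\<^sub>0\<^sup>2) Re (\<i> g\<^sub>2\<^sub>0 g\<^sub>1\<^sub>1 + \<omega>\<^sub>0 g\<^sub>2\<^sub>1)\<close> for planar systems.
  Replacing \<open>q\<close> by \<open>z q\<close> (and \<open>p\<close> by \<open>p / cnj z\<close>) multiplies it by \<open>\<bar>z\<bar>\<^sup>2\<close>, so its sign
  does not depend on the choice of eigenvectors.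
\<close>

definition first_lyapunov ::
    "(real^2 \<Rightarrow> real^2) \<Rightarrow> real \<Rightarrow> complex^2 \<Rightarrow> complex^2 \<Rightarrow> real" where
  "first_lyapunov F \<omega>\<^sub>0 q p =
     (let g20 = cinner2 p (bilinear_part F q q);
          g11 = cinner2 p (bilinear_part F q (cconj2 q));
          g21 = cinner2 p (trilinear_part F q q (cconj2 q))
      in Re (\<i> * g20 * g11 + complex_of_real \<omega>\<^sub>0 * g21) / (2 * \<omega>\<^sub>0\<^sup>2))"

text \<open>
  If \<open>\<phi> 0 \<noteq> 0\<close>, the smoothed system has its Hopf bifurcation at a shifted value of \<open>\<mu>\<close>
  (or, for large coefficients, none), so \<open>\<mu>\<close> ranges over all Hopf points.
  A vanishing coefficient leaves the criticality undetermined, so it is not compared; hence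
  \<open>\<not> preserves_criticality \<omega> \<phi>\<close> says that for some coefficients the criticality is
  reversed.
\<close>

definition preserves_criticality :: "real \<Rightarrow> (real \<Rightarrow> real) \<Rightarrow> bool" where
  "preserves_criticality \<omega> \<phi> \<longleftrightarrow>
     (\<forall>a b \<mu> \<omega>\<^sub>0 q p.
        hopf_eigendata (planar_field \<phi> \<omega> a b \<mu>) \<omega>\<^sub>0 q p \<longrightarrow>
        sigma_nonsmooth a b \<noteq> 0 \<longrightarrow>
        first_lyapunov (planar_field \<phi> \<omega> a b \<mu>) \<omega>\<^sub>0 q p \<noteq> 0 \<longrightarrow>
        sgn (first_lyapunov (planar_field \<phi> \<omega> a b \<mu>) \<omega>\<^sub>0 q p) = sgn (sigma_nonsmooth a b))"

end

theory Submission
  imports Defs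
begin

text \<open>
  Take \<open>a = (A, D; -D, D)\<close>, \<open>b = (D, -D; D, A)\<close> and \<open>\<mu> = -(A + D) \<Phi>(0)\<close>. The row sums of \<open>a\<close>
  and \<open>b\<close> are such that the linear terms produced by \<open>\<Phi>(0)\<close> are a multiple of the identity, which
  the choice of \<open>\<mu>\<close> cancels, so the linearization is the rotation \<open>(0, -\<omega>; \<omega>, 0)\<close>. The quadratic
  terms produced by \<open>\<Phi>'(0)\<close> make \<open>g\<^sub>2\<^sub>0 g\<^sub>1\<^sub>1\<close> real, so they do not contribute. What remains of the
  Lyapunov coefficient is \<open>(3A + D) \<Phi>''(0) / (2\<bar>\<omega>\<bar>)\<close>, whereas \<open>\<sigma>\<^sub># = 4A + 2D\<close>: by the choice of
  \<open>D / A\<close>, the numbers \<open>3A + D\<close> and \<open>4A + 2D\<close> can be given equal or opposite signs.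
\<close>

lemma smooth_has_real_derivative:
  assumes "smooth \<phi>"
  shows "((deriv ^^ n) \<phi> has_real_derivative (deriv ^^ Suc n) \<phi> x) (at x)"
  using assms by (simp add: smooth_def DERIV_deriv_iff_real_differentiable)

text \<open>Stated as an equality of functions on the whole plane, not of values at one point, so
  that it applies again to its own right-hand side and yields higher partial derivatives by
  iteration.\<close>

lemma partial_1_eq:
  assumes "\<And>v w. ((\<lambda>t. G t w) has_real_derivative G' v w) (at v)"
  shows "partial 1 (\<lambda>x. G (x$1) (x$2)) = (\<lambda>x. G' (x$1) (x$2))"
proof
  fix x :: "real^2"
  have "((\<lambda>t. G (x$1 + t) (x$2)) has_real_derivative G' (x$1) (x$2)) (at 0)"
    using assms by (simp add: add.commute[of "x$1"]
        flip: DERIV_shift[where f = "\<lambda>t. G t (x$2)" and x = 0, simplified])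
  then show "partial 1 (\<lambda>x. G (x$1) (x$2)) x = G' (x$1) (x$2)"
    by (simp add: partial_def axis_def DERIV_imp_deriv)
qed

lemma partial_2_eq:
  assumes "\<And>v w. ((\<lambda>t. G v t) has_real_derivative G' v w) (at w)"
  shows "partial 2 (\<lambda>x. G (x$1) (x$2)) = (\<lambda>x. G' (x$1) (x$2))"
proof
  fix x :: "real^2"
  have "((\<lambda>t. G (x$1) (x$2 + t)) has_real_derivative G' (x$1) (x$2)) (at 0)"
    using assms by (simp add: add.commute[of "x$2"] flip: DERIV_shift[where x = 0, simplified])
  then show "partial 2 (\<lambda>x. G (x$1) (x$2)) x = G' (x$1) (x$2)"
    by (simp add: partial_def axis_def DERIV_imp_deriv)
qed

text \<open>Common shape of both components of \<open>planar_field\<close>, so that all partial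
  derivatives need computing only once.\<close>

definition component_fun ::
    "(real \<Rightarrow> real) \<Rightarrow> real \<Rightarrow> real \<Rightarrow> real^2^2 \<Rightarrow> real^2 \<Rightarrow> real" where
  "component_fun \<phi> \<alpha> \<beta> c x = \<alpha> * x$1 + \<beta> * x$2 + nonlinearity \<phi> c (x$1) (x$2)"

lemma planar_field_component:
  "planar_field \<phi> \<omega> a b \<mu> x $ 1 = component_fun \<phi> \<mu> (- \<omega>) a x"
  "planar_field \<phi> \<omega> a b \<mu> x $ 2 = component_fun \<phi> \<omega> \<mu> b x"
  by (simp_all add: planar_field_def component_fun_def Let_def)

context
  fixes \<phi> :: "real \<Rightarrow> real" and \<alpha> \<beta> :: real and c :: "real^2^2"
  assumes smooth: "smooth \<phi>"
begin

private abbreviation (input) "d1 \<equiv> deriv \<phi>"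
private abbreviation (input) "d2 \<equiv> deriv d1"
private abbreviation (input) "d3 \<equiv> deriv d2"
private abbreviation (input) "h \<equiv> component_fun \<phi> \<alpha> \<beta> c"

private lemma derivs [derivative_intros]:
  "(\<phi> has_real_derivative d1 x) (at x)"
  "(d1 has_real_derivative d2 x) (at x)"
  "(d2 has_real_derivative d3 x) (at x)"
  using smooth_has_real_derivative[OF smooth, of 0] smooth_has_real_derivative[OF smooth, of 1]
    smooth_has_real_derivative[OF smooth, of 2]
  by (simp_all add: numeral_2_eq_2)

private lemma partial_h:
  "partial 1 h =
    (\<lambda>x. \<alpha> + c$1$1 * (\<phi> (x$1) + x$1 * d1 (x$1)) + c$1$2 * \<phi> (x$2) + c$2$1 * x$2 * d1 (x$1))"
  "partial 2 h =
    (\<lambda>x. \<beta> + c$1$2 * x$1 * d1 (x$2) + c$2$1 * \<phi> (x$1) + c$2$2 * (\<phi> (x$2) + x$2 * d1 (x$2)))"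
  unfolding component_fun_def nonlinearity_def
  by (rule partial_1_eq partial_2_eq, (rule derivative_eq_intros derivs refl)+,
      simp add: algebra_simps)+

private lemma partial_partial_h:
  "partial 1 (partial 1 h) =
    (\<lambda>x. c$1$1 * (2 * d1 (x$1) + x$1 * d2 (x$1)) + c$2$1 * x$2 * d2 (x$1))"
  "partial 1 (partial 2 h) = (\<lambda>x. c$1$2 * d1 (x$2) + c$2$1 * d1 (x$1))"
  "partial 2 (partial 1 h) = (\<lambda>x. c$1$2 * d1 (x$2) + c$2$1 * d1 (x$1))"
  "partial 2 (partial 2 h) =
    (\<lambda>x. c$1$2 * x$1 * d2 (x$2) + c$2$2 * (2 * d1 (x$2) + x$2 * d2 (x$2)))"
  unfolding partial_h
  by (rule partial_1_eq partial_2_eq, (rule derivative_eq_intros derivs refl)+,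
      simp add: algebra_simps)+

private lemma partial_partial_partial_h:
  "partial 1 (partial 1 (partial 1 h)) =
    (\<lambda>x. c$1$1 * (3 * d2 (x$1) + x$1 * d3 (x$1)) + c$2$1 * x$2 * d3 (x$1))"
  "partial 2 (partial 1 (partial 1 h)) = (\<lambda>x. c$2$1 * d2 (x$1))"
  "partial 1 (partial 1 (partial 2 h)) = (\<lambda>x. c$2$1 * d2 (x$1))"
  "partial 2 (partial 1 (partial 2 h)) = (\<lambda>x. c$1$2 * d2 (x$2))"
  "partial 1 (partial 2 (partial 1 h)) = (\<lambda>x. c$2$1 * d2 (x$1))"
  "partial 2 (partial 2 (partial 1 h)) = (\<lambda>x. c$1$2 * d2 (x$2))"
  "partial 1 (partial 2 (partial 2 h)) = (\<lambda>x. c$1$2 * d2 (x$2))"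
  "partial 2 (partial 2 (partial 2 h)) =
    (\<lambda>x. c$1$2 * x$1 * d3 (x$2) + c$2$2 * (3 * d2 (x$2) + x$2 * d3 (x$2)))"
  unfolding partial_partial_h
  by (rule partial_1_eq partial_2_eq, (rule derivative_eq_intros derivs refl)+,
      simp add: algebra_simps)+

text \<open>At the origin every term with a coordinate as a factor vanishes, in particular all those
  with \<open>d3\<close>. The partials of order 1, 2 and 3 thus see the nonlinearity only through
  \<open>\<phi> 0\<close>, \<open>d1 0\<close> and \<open>d2 0\<close> respectively. Each order of
  differentiation is listed, since \<open>bilinear_part\<close> and \<open>trilinear_part\<close>
  sum over all of them.\<close>

lemma component_partials_at_0:
  "partial 1 h 0 = \<alpha> + (c$1$1 + c$1$2) * \<phi> 0"
  "partial 2 h 0 = \<beta> + (c$2$1 + c$2$2) * \<phi> 0"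
  "partial 1 (partial 1 h) 0 = 2 * c$1$1 * d1 0"
  "partial 1 (partial 2 h) 0 = (c$1$2 + c$2$1) * d1 0"
  "partial 2 (partial 1 h) 0 = (c$1$2 + c$2$1) * d1 0"
  "partial 2 (partial 2 h) 0 = 2 * c$2$2 * d1 0"
  "partial 1 (partial 1 (partial 1 h)) 0 = 3 * c$1$1 * d2 0"
  "partial 2 (partial 1 (partial 1 h)) 0 = c$2$1 * d2 0"
  "partial 1 (partial 1 (partial 2 h)) 0 = c$2$1 * d2 0"
  "partial 2 (partial 1 (partial 2 h)) 0 = c$1$2 * d2 0"
  "partial 1 (partial 2 (partial 1 h)) 0 = c$2$1 * d2 0"
  "partial 2 (partial 2 (partial 1 h)) 0 = c$1$2 * d2 0"
  "partial 1 (partial 2 (partial 2 h)) 0 = c$1$2 * d2 0"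
  "partial 2 (partial 2 (partial 2 h)) 0 = 3 * c$2$2 * d2 0"
  unfolding partial_partial_partial_h unfolding partial_partial_h unfolding partial_h
  by (simp_all add: algebra_simps)

end

definition coeffs_a :: "real \<Rightarrow> real \<Rightarrow> real^2^2" where
  "coeffs_a A D = vector [vector [A, D], vector [- D, D]]"

definition coeffs_b :: "real \<Rightarrow> real \<Rightarrow> real^2^2" where
  "coeffs_b A D = vector [vector [D, - D], vector [D, A]]"

lemma coeffs_nth [simp]:
  "coeffs_a A D $ 1 $ 1 = A" "coeffs_a A D $ 1 $ 2 = D"
  "coeffs_a A D $ 2 $ 1 = - D" "coeffs_a A D $ 2 $ 2 = D"
  "coeffs_b A D $ 1 $ 1 = D" "coeffs_b A D $ 1 $ 2 = - D"
  "coeffs_b A D $ 2 $ 1 = D" "coeffs_b A D $ 2 $ 2 = A"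
  by (simp_all add: coeffs_a_def coeffs_b_def)

lemma sigma_nonsmooth_coeffs: "sigma_nonsmooth (coeffs_a A D) (coeffs_b A D) = 4 * A + 2 * D"
  by (simp add: sigma_nonsmooth_def)

definition test_field :: "(real \<Rightarrow> real) \<Rightarrow> real \<Rightarrow> real \<Rightarrow> real \<Rightarrow> real^2 \<Rightarrow> real^2" where
  "test_field \<phi> \<omega> A D =
     planar_field \<phi> \<omega> (coeffs_a A D) (coeffs_b A D) (- (A + D) * \<phi> 0)"

text \<open>The factor \<open>sgn \<omega>\<close> makes the eigenvalue
  \<open>\<i> * \<bar>\<omega>\<bar>\<close>, with positive imaginary part for either sense of
  rotation.\<close>

definition rotation_eigenvector :: "real \<Rightarrow> complex^2" where
  "rotation_eigenvector \<omega> = vector [1, - \<i> * complex_of_real (sgn \<omega>)]"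

text \<open>The rotation matrix is skew-symmetric, so its transpose has the same eigenvectors with
  negated eigenvalues. Hence half of \<open>rotation_eigenvector\<close> serves, the half giving the
  normalization \<open>cinner2 p q = 1\<close>.\<close>

definition rotation_adjoint_eigenvector :: "real \<Rightarrow> complex^2" where
  "rotation_adjoint_eigenvector \<omega> = vector [1 / 2, - \<i> * complex_of_real (sgn \<omega>) / 2]"

lemma hopf_eigendata_test_field:
  assumes "smooth \<phi>" "\<omega> \<noteq> 0"
  shows "hopf_eigendata (test_field \<phi> \<omega> A D) \<bar>\<omega>\<bar>
           (rotation_eigenvector \<omega>) (rotation_adjoint_eigenvector \<omega>)"
proof -
  have "test_field \<phi> \<omega> A D 0 = 0"
    by (simp add: test_field_def vec_eq_iff forall_2 planar_field_component component_fun_def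
        nonlinearity_def)
  moreover have "jacobian0 (test_field \<phi> \<omega> A D) =
      vector [vector [0, - complex_of_real \<omega>], vector [complex_of_real \<omega>, 0]]"
    by (simp add: jacobian0_def vec_eq_iff forall_2 test_field_def planar_field_component
        component_partials_at_0[OF assms(1)] algebra_simps)
  moreover have "\<omega> > 0 \<or> \<omega> < 0" using assms(2) by auto
  ultimately show ?thesis
    unfolding hopf_eigendata_def
    by (auto simp: complex_eq_iff vec_eq_iff forall_2 matrix_vector_mult_def sum_2 transpose_def cinner2_def
        rotation_eigenvector_def rotation_adjoint_eigenvector_def)
qed

lemma first_lyapunov_test_field:
  assumes "smooth \<phi>" "\<omega> \<noteq> 0"
  shows "first_lyapunov (test_field \<phi> \<omega> A D) \<bar>\<omega>\<bar>
           (rotation_eigenvector \<omega>) (rotation_adjoint_eigenvector \<omega>) =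
         (3 * A + D) * (deriv ^^ 2) \<phi> 0 / (2 * \<bar>\<omega>\<bar>)"
proof -
  define F q p where "F = test_field \<phi> \<omega> A D" and "q = rotation_eigenvector \<omega>"
    and "p = rotation_adjoint_eigenvector \<omega>"
  define s where "s = sgn \<omega>"
  have s: "s = 1 \<or> s = - 1"
    using assms(2) by (auto simp: s_def sgn_if)
  note components = F_def test_field_def planar_field_component component_partials_at_0[OF assms(1)]
    q_def p_def rotation_eigenvector_def rotation_adjoint_eigenvector_def s_def[symmetric] cconj2_def
  have g20: "cinner2 p (bilinear_part F q q) =
      complex_of_real (deriv \<phi> 0 * (A - D)) * (1 - \<i> * complex_of_real s)"
    using s by (auto simp: cinner2_def bilinear_part_def sum_2 components complex_eq_iff field_simps)
  have g11: "cinner2 p (bilinear_part F q (cconj2 q)) =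
      complex_of_real (deriv \<phi> 0 * (A + D)) * (1 + \<i> * complex_of_real s)"
    using s by (auto simp: cinner2_def bilinear_part_def sum_2 components complex_eq_iff field_simps)
  \<comment> \<open>Its weight in the Lyapunov coefficient is the real number
    \<open>\<bar>\<omega>\<bar>\<close>, so the real part suffices.\<close>
  have g21: "Re (cinner2 p (trilinear_part F q q (cconj2 q))) = (3 * A + D) * (deriv ^^ 2) \<phi> 0"
    using s by (auto simp: cinner2_def trilinear_part_def sum_2 components field_simps numeral_2_eq_2)
  \<comment> \<open>The complex factors of \<open>g20\<close> and \<open>g11\<close> are conjugate,
    with product \<open>1 + s^2 = 2\<close>; multiplying this real product by \<open>\<i>\<close>
    leaves no real part.\<close>
  have "Re (\<i> * cinner2 p (bilinear_part F q q) * cinner2 p (bilinear_part F q (cconj2 q))) = 0"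
    unfolding g20 g11 using s by auto
  then have "first_lyapunov F \<bar>\<omega>\<bar> q p = \<bar>\<omega>\<bar> * ((3 * A + D) * (deriv ^^ 2) \<phi> 0) / (2 * \<bar>\<omega>\<bar>\<^sup>2)"
    unfolding first_lyapunov_def Let_def by (simp add: g21 del: power2_abs)
  then show ?thesis
    using assms(2) by (simp add: F_def q_def p_def power2_eq_square del: abs_mult_self_eq)
qed

theorem lemma3p7:
  fixes \<omega> \<epsilon> :: real and \<Phi> :: "real \<Rightarrow> real \<Rightarrow> real"
  assumes "\<omega> \<noteq> 0"
    and "smooth_abs_approximation \<Phi>"
    and "\<epsilon> > 0"
    and "(deriv ^^ 2) (\<Phi> \<epsilon>) 0 \<noteq> 0"
  shows "\<not> preserves_criticality \<omega> (\<Phi> \<epsilon>)"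
proof
  assume preserves: "preserves_criticality \<omega> (\<Phi> \<epsilon>)"
  define k where "k = (deriv ^^ 2) (\<Phi> \<epsilon>) 0"
  have smooth: "smooth (\<Phi> \<epsilon>)"
    using assms(2,3) by (simp add: smooth_abs_approximation_def)
  \<comment> \<open>The condition on \<open>3 * A + D\<close> keeps the Lyapunov coefficient
    nonzero, so that the two signs are compared at all.\<close>
  have same_sign: "sgn ((3 * A + D) * k / (2 * \<bar>\<omega>\<bar>)) = sgn (4 * A + 2 * D)"
    if "4 * A + 2 * D \<noteq> 0" "3 * A + D \<noteq> 0" for A D
    using preserves[unfolded preserves_criticality_def, rule_format,
        OF hopf_eigendata_test_field[OF smooth assms(1), of A D, unfolded test_field_def]]
      first_lyapunov_test_field[OF smooth assms(1), of A D, unfolded test_field_def]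
      that assms(1,4)
    by (simp add: sigma_nonsmooth_coeffs k_def)
  show False
  proof (cases "k > 0")
    case True
    \<comment> \<open>Here \<open>3 * A + D = 1\<close> and \<open>4 * A + 2 * D = -2\<close> have
      opposite signs, and \<open>k > 0\<close> keeps them opposite.\<close>
    then show False
      using same_sign[of 2 "-5"] assms(1) by (simp add: sgn_mult sgn_divide)
  next
    case False
    then have "k < 0" using assms(4) by (simp add: k_def)
    \<comment> \<open>Here the values are 3 and 4, of equal sign, and \<open>k < 0\<close> reverses
      the first.\<close>
    then show False
      using same_sign[of 1 0] assms(1) by (simp add: sgn_mult sgn_divide)
  qed
qed

end
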